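(* Let $p\ge5$. Let $W\sim\mathrm{BetaPrime}(1,\tfrac p2-2)$, $\boldsymbol{\theta}\mid W\sim N_p(\boldsymbol{0}_p,W I_p)$ and $\boldsymbol{Y}\mid\boldsymbol{\theta},W\sim N_p(\boldsymbol{\theta},I_p)$. Then the proper Bayes estimate $$\boldsymbol{\delta}(\boldsymbol{Y})=\mathbb{E}\!\left[\frac{W}{1+W}\,\Big|\,\boldsymbol{Y}\right]\boldsymbol{Y}$$ is admissible for estimating $\boldsymbol{\theta}$ under quadratic loss in the model $\boldsymbol{Y}\mid\boldsymbol{\theta}\sim N_p(\boldsymbol{\theta},I_p)$.
   Context: $\mathrm{BetaPrime}(1,b)$ has density $h(w)=b(1+w)^{-(b+1)}$ on $w>0$; here $b=\tfrac p2-2$. The conditional expectation is taken under the stated joint law of $(W,\boldsymbol{\theta},\boldsymbol{Y})$. The loss is $\|\boldsymbol{\theta}-\boldsymbol{\delta}\|^2$ and the risk is $R(\boldsymbol{\theta},\boldsymbol{\delta})=\mathbb{E}_{\boldsymbol{\theta}}[\|\boldsymbol{\theta}-\boldsymbol{\delta}(\boldsymbol{Y})\|^2]$, $\boldsymbol{\theta}\in\mathbb{R}^p$. An estimator $\boldsymbol{\delta}$ is admissible if there is no estimator $\boldsymbol{\delta}'$ with $R(\boldsymbol{\theta},\boldsymbol{\delta}')\le R(\boldsymbol{\theta},\boldsymbol{\delta})$ for all $\boldsymbol{\theta}$ and strict inequality for at least one $\boldsymbol{\theta}$. *)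

theory Defs
  imports "HOL-Probability.Probability"
begin

definition beta_prime_1_density :: "real \<Rightarrow> real \<Rightarrow> real" where
  "beta_prime_1_density b w = (if w > 0 then b * (1 + w) powr (-(b + 1)) else 0)"

text \<open>Lebesgue density of \<open>N\<^sub>p(\<mu>, s I\<^sub>p)\<close>, where \<open>p = CARD('n)\<close>. The argument \<open>s\<close> is the
  variance (not the standard deviation) and is only meaningful for \<open>s > 0\<close>.\<close>
definition mvn_density :: "real ^ 'n::finite \<Rightarrow> real \<Rightarrow> real ^ 'n \<Rightarrow> real" where
  "mvn_density \<mu> s x =
     (2 * pi * s) powr (- real CARD('n) / 2) * exp (- (norm (x - \<mu>))\<^sup>2 / (2 * s))"

definition mvn :: "real ^ 'n::finite \<Rightarrow> real \<Rightarrow> (real ^ 'n) measure" where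
  "mvn \<mu> s = density lborel (\<lambda>x. ennreal (mvn_density \<mu> s x))"

text \<open>The hierarchy \<open>W \<sim> BetaPrime(1, b)\<close>, \<open>\<theta> | W \<sim> N\<^sub>p(0, W I\<^sub>p)\<close>, \<open>Y | \<theta>, W \<sim> N\<^sub>p(\<theta>, I\<^sub>p)\<close>:
  the joint density is the marginal density of \<open>W\<close> times the two conditional densities.
  It vanishes for \<open>w \<le> 0\<close>, so the values of \<^const>\<open>mvn_density\<close> there are irrelevant.\<close>
definition hierarchical_density ::
    "real \<Rightarrow> real \<times> (real ^ 'n::finite) \<times> (real ^ 'n) \<Rightarrow> real" where
  "hierarchical_density b =
     (\<lambda>(w, \<theta>, y). beta_prime_1_density b w * mvn_density 0 w \<theta> * mvn_density \<theta> 1 y)"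

abbreviation estimator :: "(real ^ 'n::finite \<Rightarrow> real ^ 'n) \<Rightarrow> bool" where
  "estimator \<delta> \<equiv> \<delta> \<in> borel_measurable borel"

text \<open>Extended-real valued, since an arbitrary estimator may have infinite risk.\<close>
definition risk :: "real ^ 'n::finite \<Rightarrow> (real ^ 'n \<Rightarrow> real ^ 'n) \<Rightarrow> ennreal" where
  "risk \<theta> \<delta> = (\<integral>\<^sup>+ y. ennreal ((norm (\<theta> - \<delta> y))\<^sup>2) \<partial>mvn \<theta> 1)"

definition admissible :: "(real ^ 'n::finite \<Rightarrow> real ^ 'n) \<Rightarrow> bool" where
  "admissible \<delta> \<longleftrightarrow> estimator \<delta> \<and>
     \<not> (\<exists>\<delta>'. estimator \<delta>' \<and> (\<forall>\<theta>. risk \<theta> \<delta>' \<le> risk \<theta> \<delta>) \<and> (\<exists>\<theta>. risk \<theta> \<delta>' < risk \<theta> \<delta>))"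

text \<open>A Bayes estimator minimises the integrated risk; it is proper if the prior has total mass 1.\<close>
definition proper_bayes_estimator ::
    "(real ^ 'n::finite) measure \<Rightarrow> (real ^ 'n \<Rightarrow> real ^ 'n) \<Rightarrow> bool" where
  "proper_bayes_estimator \<pi> \<delta> \<longleftrightarrow>
     prob_space \<pi> \<and> sets \<pi> = sets borel \<and> estimator \<delta> \<and>
     (\<integral>\<^sup>+ \<theta>. risk \<theta> \<delta> \<partial>\<pi>) < \<infinity> \<and>
     (\<forall>\<delta>'. estimator \<delta>' \<longrightarrow> (\<integral>\<^sup>+ \<theta>. risk \<theta> \<delta> \<partial>\<pi>) \<le> (\<integral>\<^sup>+ \<theta>. risk \<theta> \<delta>' \<partial>\<pi>))"

end

(* Given Y = y and W = w, the posterior of theta is N(s y, s I) with s = w / (1 + w). Integrating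
   out theta first, the integrated risk of any estimator d is that of the posterior mean c(y) y,
   where c(y) = E[s | Y = y], plus the integral of m(y) |c(y) y - d(y)|^2, where m is the density of
   Y. The integrated risk of c(y) y is finite, since that of the identity estimator is p, and m is
   positive everywhere. Hence an estimator whose risk is nowhere larger agrees with c(y) y almost
   everywhere and so has the same risk function. The decomposition is done pointwise in y rather
   than in L2, as theta is not even integrable when p = 5. *)

theory Submission
  imports Defs
begin

section \<open>Isotropic Gaussian densities and their second moments\<close>

lemma mvn_density_nonneg [simp]: "0 \<le> mvn_density \<mu> s x"
  by (simp add: mvn_density_def)

lemma mvn_density_pos: "0 < s \<Longrightarrow> 0 < mvn_density \<mu> s x"
  by (simp add: mvn_density_def)

lemma measurable_mvn_density [measurable (raw)]:
  assumes [measurable]: "f \<in> borel_measurable M" "g \<in> borel_measurable M" "h \<in> borel_measurable M"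
  shows "(\<lambda>x. mvn_density (f x) (g x) (h x)) \<in> borel_measurable M"
  unfolding mvn_density_def by measurable

text \<open>With covariance s I the coordinates are independent, so integrals against this density
  factor into one-dimensional ones. The library density takes a standard deviation, hence
  \<open>sqrt s\<close>.\<close>

lemma mvn_density_eq_prod:
  fixes x :: "real ^ 'n::finite"
  assumes "0 < s"
  shows "mvn_density \<mu> s x = (\<Prod>b\<in>Basis. normal_density (\<mu> \<bullet> b) (sqrt s) (x \<bullet> b))"
proof -
  have "(\<Prod>b\<in>Basis. normal_density (\<mu> \<bullet> b) (sqrt s) (x \<bullet> b))
      = (1 / sqrt (2 * pi * s)) ^ CARD('n) * exp (\<Sum>b\<in>Basis. - (x \<bullet> b - \<mu> \<bullet> b)\<^sup>2 / (2 * s))"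
    using assms by (simp add: normal_density_def prod.distrib exp_sum power_divide prod_dividef)
  also have "(\<Sum>b\<in>Basis. - (x \<bullet> b - \<mu> \<bullet> b)\<^sup>2 / (2 * s)) = - (norm (x - \<mu>))\<^sup>2 / (2 * s)"
    unfolding power2_norm_eq_inner euclidean_inner[of "x - \<mu>" "x - \<mu>"]
    by (simp add: sum_divide_distrib sum_negf inner_diff_left power2_eq_square)
  also have "(1 / sqrt (2 * pi * s)) ^ CARD('n) = (2 * pi * s) powr (- real CARD('n) / 2)"
    using assms
    by (simp add: powr_half_sqrt[symmetric] powr_minus_divide powr_powr powr_realpow[symmetric]
        power_one_over)
  finally show ?thesis
    by (simp add: mvn_density_def)
qed

lemma nn_integral_normal_density:
  assumes "0 < \<sigma>"
  shows "(\<integral>\<^sup>+x. ennreal (normal_density \<mu> \<sigma> x) \<partial>lborel) = 1"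
  using assms by (simp add: nn_integral_eq_integral)

text \<open>Expand (x - a)^2 around the mean: the cross term is a first central moment and
  vanishes.\<close>

lemma nn_integral_normal_second_moment:
  assumes "0 < \<sigma>"
  shows "(\<integral>\<^sup>+x. ennreal (normal_density \<mu> \<sigma> x * (x - a)\<^sup>2) \<partial>lborel) = ennreal (\<sigma>\<^sup>2 + (\<mu> - a)\<^sup>2)"
proof -
  let ?N = "normal_density \<mu> \<sigma>"
  have 0: "has_bochner_integral lborel ?N 1"
    using normal_moment_even[OF assms, of \<mu> 0] by simp
  have 1: "has_bochner_integral lborel (\<lambda>x. ?N x * (x - \<mu>)) 0"
    using normal_moment_odd[OF assms, of \<mu> 0] by simp
  have 2: "has_bochner_integral lborel (\<lambda>x. ?N x * (x - \<mu>)\<^sup>2) (\<sigma>\<^sup>2)"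
    using normal_moment_even[OF assms, of \<mu> 1] by simp
  have "has_bochner_integral lborel
      (\<lambda>x. ?N x * (x - \<mu>)\<^sup>2 + (?N x * (x - \<mu>) * (2 * (\<mu> - a)) + ?N x * (\<mu> - a)\<^sup>2))
      (\<sigma>\<^sup>2 + (0 * (2 * (\<mu> - a)) + 1 * (\<mu> - a)\<^sup>2))"
    by (intro has_bochner_integral_add has_bochner_integral_mult_left 0 1 2)
  also have "(\<lambda>x. ?N x * (x - \<mu>)\<^sup>2 + (?N x * (x - \<mu>) * (2 * (\<mu> - a)) + ?N x * (\<mu> - a)\<^sup>2))
      = (\<lambda>x. ?N x * (x - a)\<^sup>2)"
    by (auto simp: fun_eq_iff power2_eq_square algebra_simps)
  finally show ?thesis
    by (auto simp: nn_integral_eq_integral has_bochner_integral_iff)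
qed

lemma nn_integral_mvn_density:
  fixes \<mu> :: "real ^ 'n::finite"
  assumes "0 < s"
  shows "(\<integral>\<^sup>+x. ennreal (mvn_density \<mu> s x) \<partial>lborel) = 1"
  using assms
  by (simp add: mvn_density_eq_prod prod_ennreal[symmetric] nn_integral_normal_density
      nn_integral_lborel_prod[where f = "\<lambda>b t. ennreal (normal_density (\<mu> \<bullet> b) (sqrt s) t)"])

lemma nn_integral_mvn_second_moment:
  fixes \<mu> a :: "real ^ 'n::finite"
  assumes "0 < s"
  shows "(\<integral>\<^sup>+x. ennreal (mvn_density \<mu> s x) * ennreal ((norm (x - a))\<^sup>2) \<partial>lborel)
    = ennreal (real CARD('n) * s + (norm (\<mu> - a))\<^sup>2)"
proof -
  have coord: "(\<integral>\<^sup>+x. ennreal (mvn_density \<mu> s x * (x \<bullet> c - a \<bullet> c)\<^sup>2) \<partial>lborel)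
      = ennreal (s + (\<mu> \<bullet> c - a \<bullet> c)\<^sup>2)" if c: "c \<in> Basis" for c
  proof -
    \<comment> \<open>The squared deviation is put into the factor of coordinate c alone; every
      other factor integrates to 1.\<close>
    let ?f = "\<lambda>b t. normal_density (\<mu> \<bullet> b) (sqrt s) t * (if b = c then (t - a \<bullet> c)\<^sup>2 else 1)"
    have "mvn_density \<mu> s x * (x \<bullet> c - a \<bullet> c)\<^sup>2 = (\<Prod>b\<in>Basis. ?f b (x \<bullet> b))" for x
      using assms c
      by (simp add: mvn_density_eq_prod prod.distrib)
    then have "(\<integral>\<^sup>+x. ennreal (mvn_density \<mu> s x * (x \<bullet> c - a \<bullet> c)\<^sup>2) \<partial>lborel)
        = (\<integral>\<^sup>+x. (\<Prod>b\<in>Basis. ennreal (?f b (x \<bullet> b))) \<partial>lborel)"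
      by (simp add: prod_ennreal)
    also have "\<dots> = (\<Prod>b\<in>Basis. \<integral>\<^sup>+t. ennreal (?f b t) \<partial>lborel)"
      by (rule nn_integral_lborel_prod) auto
    also have "\<dots> = (\<Prod>b\<in>Basis. if b = c then ennreal (s + (\<mu> \<bullet> c - a \<bullet> c)\<^sup>2) else 1)"
      using assms
      by (intro prod.cong) (auto simp: nn_integral_normal_density nn_integral_normal_second_moment)
    finally show ?thesis
      using c by simp
  qed
  have norm_eq: "(norm (x - a))\<^sup>2 = (\<Sum>c\<in>Basis. (x \<bullet> c - a \<bullet> c)\<^sup>2)" for x
    unfolding power2_norm_eq_inner euclidean_inner[of "x - a" "x - a"]
    by (simp add: inner_diff_left power2_eq_square)
  have "(\<integral>\<^sup>+x. ennreal (mvn_density \<mu> s x) * ennreal ((norm (x - a))\<^sup>2) \<partial>lborel)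
      = (\<integral>\<^sup>+x. (\<Sum>c\<in>Basis. ennreal (mvn_density \<mu> s x * (x \<bullet> c - a \<bullet> c)\<^sup>2)) \<partial>lborel)"
    by (simp add: norm_eq sum_ennreal ennreal_mult[symmetric] sum_nonneg sum_distrib_left)
  also have "\<dots> = (\<Sum>c\<in>Basis. ennreal (s + (\<mu> \<bullet> c - a \<bullet> c)\<^sup>2))"
    by (subst nn_integral_sum) (auto intro!: sum.cong simp: coord)
  also have "\<dots> = ennreal (real CARD('n) * s + (norm (\<mu> - a))\<^sup>2)"
    using assms by (subst sum_ennreal) (auto simp: norm_eq sum.distrib)
  finally show ?thesis .
qed

text \<open>Bayes' rule for a fixed w, by completing the square in theta. The left side factors as
  prior times likelihood, the right side as marginal of y times posterior of theta. The normalising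
  constants agree because w * 1 = (1 + w) * (w / (1 + w)).\<close>

lemma mvn_density_mult:
  fixes \<theta> y :: "real ^ 'n::finite"
  assumes "0 < w"
  shows "mvn_density 0 w \<theta> * mvn_density \<theta> 1 y
    = mvn_density 0 (1 + w) y * mvn_density ((w / (1 + w)) *\<^sub>R y) (w / (1 + w)) \<theta>"
proof -
  have "(norm \<theta>)\<^sup>2 / (2 * w) + (norm (y - \<theta>))\<^sup>2 / 2
      = (norm y)\<^sup>2 / (2 * (1 + w)) + (norm (\<theta> - (w / (1 + w)) *\<^sub>R y))\<^sup>2 / (2 * (w / (1 + w)))"
  proof -
    have w: "w \<noteq> 0" "1 + w \<noteq> 0" using assms by auto
    show ?thesis
      unfolding power2_norm_eq_inner
      using w by (simp add: inner_diff_left inner_diff_right inner_commute[of y \<theta>] divide_simps)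
         (simp add: algebra_simps)
  qed
  then have exps: "exp (- (norm \<theta>)\<^sup>2 / (2 * w)) * exp (- (norm (y - \<theta>))\<^sup>2 / 2)
      = exp (- (norm y)\<^sup>2 / (2 * (1 + w)))
        * exp (- (norm (\<theta> - (w / (1 + w)) *\<^sub>R y))\<^sup>2 / (2 * (w / (1 + w))))"
    by (simp only: exp_add[symmetric]) simp
  have "(2 * pi * w) powr r * (2 * pi) powr r
      = (2 * pi * (1 + w)) powr r * (2 * pi * (w / (1 + w))) powr r" for r
  proof -
    have "(2 * pi * w) * (2 * pi) = (2 * pi * (1 + w)) * (2 * pi * (w / (1 + w)))"
      using assms by simp
    then show ?thesis
      by (simp only: powr_mult[symmetric])
  qed
  from arg_cong2[where f = "(*)", OF this[of "- real CARD('n) / 2"] exps] show ?thesis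
    unfolding mvn_density_def diff_zero mult_1_right by (simp only: ac_simps)
qed

lemma beta_prime_1_density_nonneg: "0 < b \<Longrightarrow> 0 \<le> beta_prime_1_density b w"
  by (simp add: beta_prime_1_density_def)

lemma measurable_beta_prime_1_density [measurable]: "beta_prime_1_density b \<in> borel_measurable borel"
  unfolding beta_prime_1_density_def by measurable

lemma measurable_hierarchical_density [measurable]:
  "hierarchical_density b \<in> borel_measurable (borel \<Otimes>\<^sub>M borel \<Otimes>\<^sub>M borel)"
  unfolding hierarchical_density_def by measurable

text \<open>Given W = w, this number is both the multiplier of y in the posterior mean of theta and
  the posterior variance of each coordinate.\<close>

definition shrinkage :: "real \<Rightarrow> real" where
  "shrinkage w = w / (1 + w)"

lemma shrinkage_bounds: "0 < w \<Longrightarrow> 0 < shrinkage w" "0 < w \<Longrightarrow> shrinkage w < 1"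
  by (auto simp: shrinkage_def field_simps)

lemma measurable_shrinkage [measurable]: "shrinkage \<in> borel_measurable borel"
  unfolding shrinkage_def by measurable

text \<open>Joint density of \<open>(W, Y)\<close>, as marginally \<open>Y | W \<sim> N\<^sub>p(0, (1 + W) I\<^sub>p)\<close>.\<close>
definition WY_density :: "real \<Rightarrow> real ^ 'n::finite \<Rightarrow> real \<Rightarrow> real" where
  "WY_density b y w = beta_prime_1_density b w * mvn_density 0 (1 + w) y"

lemma measurable_WY_density [measurable (raw)]:
  assumes [measurable]: "f \<in> borel_measurable M" "g \<in> borel_measurable M"
  shows "(\<lambda>x. WY_density b (f x) (g x)) \<in> borel_measurable M"
  unfolding WY_density_def by measurable

lemma WY_density_nonneg: "0 < b \<Longrightarrow> 0 \<le> WY_density b y w"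
  by (simp add: WY_density_def beta_prime_1_density_nonneg)

lemma WY_density_eq_0: "w \<le> 0 \<Longrightarrow> WY_density b y w = 0"
  by (simp add: WY_density_def beta_prime_1_density_def)

lemma WY_density_pos: "0 < b \<Longrightarrow> 0 < w \<Longrightarrow> 0 < WY_density b y w"
  by (simp add: WY_density_def beta_prime_1_density_def mvn_density_pos)

text \<open>For w > 0 this is \<open>mvn_density_mult\<close>; for w \<le> 0 both sides are 0
  through the density of W, so the identity can be used under integrals over the whole line.\<close>

lemma hierarchical_density_eq:
  "hierarchical_density b (w, \<theta>, y) = WY_density b y w * mvn_density (shrinkage w *\<^sub>R y) (shrinkage w) \<theta>"
proof (cases "0 < w")
  case True
  then show ?thesis
    using mvn_density_mult[of w \<theta> y]
    by (simp add: hierarchical_density_def WY_density_def shrinkage_def mult.assoc)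
next
  case False
  then show ?thesis
    by (simp add: hierarchical_density_def WY_density_def beta_prime_1_density_def)
qed

section \<open>Risk functions\<close>

lemma risk_eq:
  assumes [measurable]: "estimator d"
  shows "risk \<theta> d = (\<integral>\<^sup>+y. ennreal (mvn_density \<theta> 1 y) * ennreal ((norm (\<theta> - d y))\<^sup>2) \<partial>lborel)"
  unfolding risk_def mvn_def by (subst nn_integral_density) auto

lemma measurable_risk:
  assumes [measurable]: "estimator d"
  shows "(\<lambda>\<theta>. risk \<theta> d) \<in> borel_measurable borel"
  unfolding risk_eq[OF assms] by measurable

text \<open>For every theta the law of Y has a Lebesgue density, so a change of the estimator on one
  Lebesgue null set leaves the whole risk function unchanged.\<close>

lemma risk_cong_AE:
  assumes "estimator d" "estimator d'" "AE y in lborel. d y = d' y"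
  shows "risk \<theta> d = risk \<theta> d'"
  unfolding risk_eq[OF assms(1)] risk_eq[OF assms(2)]
  using assms(3) by (intro nn_integral_cong_AE) auto

text \<open>The constant risk of the identity is the finite benchmark that later bounds the minimal
  integrated risk.\<close>

lemma risk_id: "risk \<theta> (\<lambda>y :: real ^ 'n::finite. y) = ennreal (real CARD('n))"
  using nn_integral_mvn_second_moment[of 1 \<theta> \<theta>] by (simp add: risk_eq norm_minus_commute)

text \<open>Puts joint measurability into a form that still applies when the arguments are permuted,
  as happens when iterated integrals are swapped.\<close>

lemma measurable_apply3:
  assumes "(\<lambda>(x, y, z). F x y z) \<in> measurable (A \<Otimes>\<^sub>M B \<Otimes>\<^sub>M C) N"
    and [measurable]: "f \<in> measurable M A" "g \<in> measurable M B" "h \<in> measurable M C"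
  shows "(\<lambda>u. F (f u) (g u) (h u)) \<in> measurable M N"
  using measurable_compose[OF _ assms(1), of "\<lambda>u. (f u, g u, h u)" M] by simp

section \<open>The joint law and its iterated integrals\<close>

locale scale_mixture_model = prob_space M for M :: "'a measure" +
  fixes W :: "'a \<Rightarrow> real" and \<Theta> Y :: "'a \<Rightarrow> real ^ 'n::finite" and b :: real
  assumes b_pos: "0 < b"
    and joint: "distributed M (lborel \<Otimes>\<^sub>M lborel \<Otimes>\<^sub>M lborel) (\<lambda>\<omega>. (W \<omega>, \<Theta> \<omega>, Y \<omega>))
      (\<lambda>z. ennreal (hierarchical_density b z))"
begin

lemma measurable_triple: "(\<lambda>\<omega>. (W \<omega>, \<Theta> \<omega>, Y \<omega>)) \<in> measurable M (borel \<Otimes>\<^sub>M borel \<Otimes>\<^sub>M borel)"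
proof -
  have "sets (lborel \<Otimes>\<^sub>M lborel \<Otimes>\<^sub>M lborel) = sets (borel \<Otimes>\<^sub>M borel \<Otimes>\<^sub>M borel)"
    by (intro sets_pair_measure_cong sets_lborel)
  then show ?thesis
    using distributed_measurable[OF joint] by (simp cong: measurable_cong_sets)
qed

lemma random_variables [measurable]:
  shows "W \<in> borel_measurable M" "\<Theta> \<in> borel_measurable M" "Y \<in> borel_measurable M"
  using measurable_comp[OF measurable_triple measurable_fst]
    measurable_comp[OF measurable_comp[OF measurable_triple measurable_snd] measurable_fst]
    measurable_comp[OF measurable_comp[OF measurable_triple measurable_snd] measurable_snd]
  by (simp_all add: comp_def)

lemma nn_integral_joint:
  assumes [measurable]: "(\<lambda>(w, \<theta>, y). F w \<theta> y) \<in> borel_measurable (borel \<Otimes>\<^sub>M borel \<Otimes>\<^sub>M borel)"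
  shows "(\<integral>\<^sup>+\<omega>. F (W \<omega>) (\<Theta> \<omega>) (Y \<omega>) \<partial>M)
    = (\<integral>\<^sup>+w. \<integral>\<^sup>+\<theta>. \<integral>\<^sup>+y. ennreal (hierarchical_density b (w, \<theta>, y)) * F w \<theta> y \<partial>lborel \<partial>lborel \<partial>lborel)"
proof -
  let ?F = "\<lambda>(w, \<theta>, y). F w \<theta> y" and ?h = "\<lambda>z. ennreal (hierarchical_density b z)"
  have sets_eq: "sets (lborel \<Otimes>\<^sub>M lborel \<Otimes>\<^sub>M lborel) = sets (borel \<Otimes>\<^sub>M borel \<Otimes>\<^sub>M borel)"
    by (intro sets_pair_measure_cong sets_lborel)
  have [measurable]: "?F \<in> borel_measurable (lborel \<Otimes>\<^sub>M lborel \<Otimes>\<^sub>M lborel)"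
    "?h \<in> borel_measurable (lborel \<Otimes>\<^sub>M lborel \<Otimes>\<^sub>M lborel)"
    by (simp_all cong: measurable_cong_sets add: measurable_cong_sets[OF sets_eq refl])
  have "(\<integral>\<^sup>+\<omega>. F (W \<omega>) (\<Theta> \<omega>) (Y \<omega>) \<partial>M) = (\<integral>\<^sup>+z. ?h z * ?F z \<partial>(lborel \<Otimes>\<^sub>M lborel \<Otimes>\<^sub>M lborel))"
    by (subst distributed_nn_integral[OF joint]) auto
  also have "\<dots> = (\<integral>\<^sup>+w. \<integral>\<^sup>+u. ?h (w, u) * ?F (w, u) \<partial>(lborel \<Otimes>\<^sub>M lborel) \<partial>lborel)"
    by (rule sigma_finite_measure.nn_integral_fst[OF sigma_finite_pair_measure, symmetric])
       (auto simp: lborel.sigma_finite_measure_axioms)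
  also have "\<dots> = (\<integral>\<^sup>+w. \<integral>\<^sup>+\<theta>. \<integral>\<^sup>+y. ?h (w, \<theta>, y) * ?F (w, \<theta>, y) \<partial>lborel \<partial>lborel \<partial>lborel)"
    by (intro nn_integral_cong lborel.nn_integral_fst[symmetric]) measurable
  finally show ?thesis by simp
qed

lemma nn_integral_posterior:
  assumes F: "(\<lambda>(w, \<theta>, y). F w \<theta> y) \<in> borel_measurable (borel \<Otimes>\<^sub>M borel \<Otimes>\<^sub>M borel)"
  shows "(\<integral>\<^sup>+\<omega>. F (W \<omega>) (\<Theta> \<omega>) (Y \<omega>) \<partial>M)
    = (\<integral>\<^sup>+y. \<integral>\<^sup>+w. ennreal (WY_density b y w) *
        (\<integral>\<^sup>+\<theta>. ennreal (mvn_density (shrinkage w *\<^sub>R y) (shrinkage w) \<theta>) * F w \<theta> y \<partial>lborel)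
        \<partial>lborel \<partial>lborel)"
proof -
  note [measurable (raw)] = measurable_apply3[OF F]
  let ?h = "\<lambda>w \<theta> y. ennreal (hierarchical_density b (w, \<theta>, y))"
  have "(\<integral>\<^sup>+\<omega>. F (W \<omega>) (\<Theta> \<omega>) (Y \<omega>) \<partial>M)
      = (\<integral>\<^sup>+w. \<integral>\<^sup>+\<theta>. \<integral>\<^sup>+y. ?h w \<theta> y * F w \<theta> y \<partial>lborel \<partial>lborel \<partial>lborel)"
    by (rule nn_integral_joint) fact
  also have "\<dots> = (\<integral>\<^sup>+w. \<integral>\<^sup>+y. \<integral>\<^sup>+\<theta>. ?h w \<theta> y * F w \<theta> y \<partial>lborel \<partial>lborel \<partial>lborel)"
    by (intro nn_integral_cong lborel_pair.Fubini') measurable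
  also have "\<dots> = (\<integral>\<^sup>+y. \<integral>\<^sup>+w. \<integral>\<^sup>+\<theta>. ?h w \<theta> y * F w \<theta> y \<partial>lborel \<partial>lborel \<partial>lborel)"
    by (rule lborel_pair.Fubini') measurable
  also have "\<dots> = (\<integral>\<^sup>+y. \<integral>\<^sup>+w. ennreal (WY_density b y w) *
        (\<integral>\<^sup>+\<theta>. ennreal (mvn_density (shrinkage w *\<^sub>R y) (shrinkage w) \<theta>) * F w \<theta> y \<partial>lborel)
        \<partial>lborel \<partial>lborel)"
    using b_pos
    by (simp add: hierarchical_density_eq ennreal_mult WY_density_nonneg mult.assoc nn_integral_cmult)
  finally show ?thesis .
qed

text \<open>The inner theta integral is over a probability density when w > 0, and the outer weight
  is 0 otherwise.\<close>

lemma nn_integral_WY: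
  assumes [measurable]: "(\<lambda>(w, y). F w y) \<in> borel_measurable (borel \<Otimes>\<^sub>M borel)"
  shows "(\<integral>\<^sup>+\<omega>. F (W \<omega>) (Y \<omega>) \<partial>M)
    = (\<integral>\<^sup>+y. \<integral>\<^sup>+w. ennreal (WY_density b y w) * F w y \<partial>lborel \<partial>lborel)"
proof -
  have "ennreal (WY_density b y w) *
        (\<integral>\<^sup>+\<theta>. ennreal (mvn_density (shrinkage w *\<^sub>R y) (shrinkage w) \<theta>) * F w y \<partial>lborel)
      = ennreal (WY_density b y w) * F w y" for w y
    by (cases "0 < w")
       (simp_all add: nn_integral_multc nn_integral_mvn_density shrinkage_bounds WY_density_eq_0)
  then show ?thesis
    by (subst nn_integral_posterior) auto
qed

text \<open>No antiderivative is computed: the total mass 1 is inherited from M, since integrating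
  the joint density over theta and y leaves the density of W.\<close>

lemma nn_integral_beta_prime_1_density: "(\<integral>\<^sup>+w. ennreal (beta_prime_1_density b w) \<partial>lborel) = 1"
proof -
  have "1 = (\<integral>\<^sup>+\<omega>. 1 \<partial>M)"
    by (simp add: emeasure_space_1)
  also have "\<dots> = (\<integral>\<^sup>+y. \<integral>\<^sup>+w. ennreal (WY_density b (y :: real ^ 'n) w) \<partial>lborel \<partial>lborel)"
    using nn_integral_WY[of "\<lambda>_ _. 1"] by simp
  also have "\<dots> = (\<integral>\<^sup>+w. \<integral>\<^sup>+y. ennreal (WY_density b (y :: real ^ 'n) w) \<partial>lborel \<partial>lborel)"
    by (rule lborel_pair.Fubini') measurable
  also have "\<dots> = (\<integral>\<^sup>+w. ennreal (beta_prime_1_density b w) \<partial>lborel)"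
  proof (rule nn_integral_cong)
    fix w :: real
    show "(\<integral>\<^sup>+y. ennreal (WY_density b (y :: real ^ 'n) w) \<partial>lborel) = ennreal (beta_prime_1_density b w)"
      using b_pos
      by (cases "0 < w")
         (simp_all add: WY_density_def ennreal_mult beta_prime_1_density_nonneg nn_integral_cmult
           nn_integral_mvn_density, simp add: beta_prime_1_density_def)
  qed
  finally show ?thesis by simp
qed

lemma integrable_beta_prime_1_density: "integrable lborel (beta_prime_1_density b)"
  using b_pos nn_integral_beta_prime_1_density
  by (auto simp: integrable_iff_bounded beta_prime_1_density_nonneg)

text \<open>For w > 0 the N(0, (1 + w) I) density never exceeds the peak (2 pi)^(-p/2) of the
  standard one, so a constant multiple of the density of W dominates.\<close>

lemma integrable_WY_density: "integrable lborel (WY_density b (y :: real ^ 'n))"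
proof (rule Bochner_Integration.integrable_bound)
  let ?C = "(2 * pi) powr (- real CARD('n) / 2)"
  show "integrable lborel (\<lambda>w. beta_prime_1_density b w * ?C)"
    using integrable_beta_prime_1_density by simp
  have "mvn_density 0 (1 + w) y \<le> ?C" if "0 < w" for w
  proof -
    have "(2 * pi * (1 + w)) powr (- real CARD('n) / 2) \<le> ?C"
      using that by (intro powr_mono2') auto
    then have "mvn_density 0 (1 + w) y \<le> ?C * 1"
      unfolding mvn_density_def using that by (intro mult_mono) auto
    then show ?thesis by simp
  qed
  then have "WY_density b y w \<le> beta_prime_1_density b w * ?C" for w
    using b_pos
    by (cases "0 < w") (auto simp: WY_density_def beta_prime_1_density_def intro!: mult_left_mono)
  then show "AE w in lborel. norm (WY_density b y w) \<le> norm (beta_prime_1_density b w * ?C)"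
    using b_pos by (auto simp: WY_density_nonneg beta_prime_1_density_nonneg)
qed simp

lemma integrable_WY_density_bounded:
  assumes [measurable]: "f \<in> borel_measurable borel" and "\<And>w. 0 < w \<Longrightarrow> \<bar>f w\<bar> \<le> K"
  shows "integrable lborel (\<lambda>w. WY_density b (y :: real ^ 'n) w * f w)"
proof (rule Bochner_Integration.integrable_bound)
  show "integrable lborel (\<lambda>w. WY_density b y w * K)"
    using integrable_WY_density by simp
  have "norm (WY_density b y w * f w) \<le> norm (WY_density b y w * K)" for w
    using assms(2)[of w]
    by (cases "0 < w") (auto simp: WY_density_eq_0 abs_mult intro!: mult_left_mono)
  then show "AE w in lborel. norm (WY_density b y w * f w) \<le> norm (WY_density b y w * K)"
    by simp
qed simp

section \<open>The marginal density of Y and the posterior mean, pointwise in y\<close>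

definition Y_density :: "real ^ 'n \<Rightarrow> real" where
  "Y_density y = (\<integral>w. WY_density b y w \<partial>lborel)"

text \<open>An explicit version of the conditional expectation of \<open>shrinkage W\<close> at Y =
  y, defined for every y; \<open>real_cond_exp_shrinkage\<close> identifies it with the abstract
  one.\<close>

definition posterior_shrinkage :: "real ^ 'n \<Rightarrow> real" where
  "posterior_shrinkage y = (\<integral>w. WY_density b y w * shrinkage w \<partial>lborel) / Y_density y"

definition posterior_mean :: "real ^ 'n \<Rightarrow> real ^ 'n" where
  "posterior_mean y = posterior_shrinkage y *\<^sub>R y"

lemma measurable_posterior [measurable]:
  shows "Y_density \<in> borel_measurable borel" "posterior_shrinkage \<in> borel_measurable borel"
    "posterior_mean \<in> borel_measurable borel"
  unfolding posterior_mean_def posterior_shrinkage_def Y_density_def by measurable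

text \<open>The integrand is strictly positive on the whole half-line w > 0. Positivity at every y
  is what later turns statements weighted by this density into Lebesgue almost-everywhere
  statements.\<close>

lemma Y_density_pos: "0 < Y_density y"
proof -
  have nn: "AE w in lborel. 0 \<le> WY_density b y w"
    using b_pos by (simp add: WY_density_nonneg)
  have "Y_density y \<noteq> 0"
  proof
    assume "Y_density y = 0"
    then have "AE w in lborel. WY_density b y w = 0"
      using integral_nonneg_eq_0_iff_AE[OF integrable_WY_density nn] by (simp add: Y_density_def)
    \<comment> \<open>Any subset of the positive half-line with positive Lebesgue measure would
      serve as well as this interval.\<close>
    then have "AE w in lborel. w \<notin> {0 <..< 1 :: real}"
      by eventually_elim (use WY_density_pos[OF b_pos, of _ y] in force)
    then have "emeasure lborel {0 <..< 1 :: real} = 0"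
      by (subst (asm) AE_iff_measurable[of "{0 <..< 1}"]) auto
    then show False by simp
  qed
  moreover have "0 \<le> Y_density y"
    unfolding Y_density_def using nn by (rule integral_nonneg_AE)
  ultimately show ?thesis by simp
qed

lemma nn_integral_WY_density_times:
  assumes [measurable]: "f \<in> borel_measurable borel" and "\<And>w. 0 < w \<Longrightarrow> \<bar>f w\<bar> \<le> K"
    and nonneg: "\<And>w. 0 < w \<Longrightarrow> 0 \<le> f w"
  shows "(\<integral>\<^sup>+w. ennreal (WY_density b y w) * ennreal (f w) \<partial>lborel)
    = ennreal (\<integral>w. WY_density b (y :: real ^ 'n) w * f w \<partial>lborel)"
proof -
  have "0 \<le> WY_density b y w * f w" for w
    using b_pos nonneg[of w] by (cases "0 < w") (simp_all add: WY_density_nonneg WY_density_eq_0)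
  then have "(\<integral>\<^sup>+w. ennreal (WY_density b y w * f w) \<partial>lborel)
      = ennreal (\<integral>w. WY_density b y w * f w \<partial>lborel)"
    by (intro nn_integral_eq_integral integrable_WY_density_bounded[OF assms(1,2)]) auto
  then show ?thesis
    using b_pos by (simp add: ennreal_mult' WY_density_nonneg)
qed

lemma nn_integral_WY_density: "(\<integral>\<^sup>+w. ennreal (WY_density b y w) \<partial>lborel) = ennreal (Y_density y)"
  using nn_integral_WY_density_times[of "\<lambda>_. 1" 1 y] by (simp add: Y_density_def)

lemma integrable_WY_density_shrinkage: "integrable lborel (\<lambda>w. WY_density b (y :: real ^ 'n) w * shrinkage w)"
  using shrinkage_bounds by (intro integrable_WY_density_bounded[where K = 1]) (auto simp: less_imp_le)

lemma integral_WY_density_shrinkage: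
  "(\<integral>w. WY_density b y w * shrinkage w \<partial>lborel) = posterior_shrinkage y * Y_density y"
  using Y_density_pos[of y] by (simp add: posterior_shrinkage_def)

lemma posterior_shrinkage_bounds: "0 \<le> posterior_shrinkage y" "posterior_shrinkage y \<le> 1"
proof -
  have bounds: "0 \<le> WY_density b y w * shrinkage w"
    "WY_density b y w * shrinkage w \<le> WY_density b y w" for w
    using b_pos shrinkage_bounds[of w] WY_density_nonneg[of b y w]
    by (cases "0 < w"; simp add: WY_density_eq_0 mult_left_le)+
  have "0 \<le> (\<integral>w. WY_density b y w * shrinkage w \<partial>lborel)"
    by (intro integral_nonneg_AE) (simp add: bounds)
  then show "0 \<le> posterior_shrinkage y"
    using Y_density_pos[of y] by (simp add: posterior_shrinkage_def)
  have "(\<integral>w. WY_density b y w * shrinkage w \<partial>lborel) \<le> Y_density y"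
    unfolding Y_density_def
    by (intro integral_mono integrable_WY_density_shrinkage integrable_WY_density bounds)
  then show "posterior_shrinkage y \<le> 1"
    using Y_density_pos[of y] by (simp add: posterior_shrinkage_def)
qed

section \<open>The law of Y and the conditional expectation given Y\<close>

lemma nn_integral_Y:
  assumes [measurable]: "f \<in> borel_measurable borel"
  shows "(\<integral>\<^sup>+\<omega>. f (Y \<omega>) \<partial>M) = (\<integral>\<^sup>+y. ennreal (Y_density y) * f y \<partial>lborel)"
  by (subst nn_integral_WY) (auto simp: nn_integral_multc nn_integral_WY_density)

text \<open>The density of Y is positive everywhere, so a Borel set that Y almost surely avoids is
  Lebesgue null.\<close>

lemma AE_lborel_if_AE_Y:
  assumes [measurable]: "Measurable.pred borel P" and "AE \<omega> in M. P (Y \<omega>)"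
  shows "AE y in lborel. P y"
proof -
  let ?I = "indicator {y. \<not> P y} :: real ^ 'n \<Rightarrow> ennreal"
  have "(\<integral>\<^sup>+y. ennreal (Y_density y) * ?I y \<partial>lborel) = (\<integral>\<^sup>+\<omega>. ?I (Y \<omega>) \<partial>M)"
    by (subst nn_integral_Y) auto
  also have "\<dots> = 0"
    using assms(2) by (subst nn_integral_0_iff_AE) auto
  finally have "AE y in lborel. ennreal (Y_density y) * ?I y = 0"
    by (subst (asm) nn_integral_0_iff_AE) auto
  then show ?thesis
  proof eventually_elim
    fix y assume "ennreal (Y_density y) * ?I y = 0"
    then show "P y"
      using Y_density_pos[of y] by (auto simp: indicator_def split: if_splits)
  qed
qed

lemma AE_W_pos: "AE \<omega> in M. 0 < W \<omega>"
proof -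
  have "(\<integral>\<^sup>+\<omega>. indicator {..0} (W \<omega>) \<partial>M)
      = (\<integral>\<^sup>+y. \<integral>\<^sup>+w. ennreal (WY_density b (y :: real ^ 'n) w) * indicator {..0} w \<partial>lborel \<partial>lborel)"
    by (rule nn_integral_WY) measurable
  also have "\<dots> = 0"
  proof -
    have *: "ennreal (WY_density b (y :: real ^ 'n) w) * indicator {..0} w = 0" for y w
      by (cases "w \<le> 0") (simp_all add: WY_density_eq_0)
    show ?thesis unfolding * by simp
  qed
  finally have "AE \<omega> in M. (indicator {..0} (W \<omega>) :: ennreal) = 0"
    by (subst (asm) nn_integral_0_iff_AE) auto
  then show ?thesis
    by eventually_elim (auto simp: indicator_def split: if_splits)
qed

text \<open>By the characterisation of conditional expectation it suffices to compare integrals over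
  the events that Y lies in B. Both equal the integral over B of \<open>posterior_shrinkage\<close>
  times \<open>Y_density\<close>.\<close>

lemma real_cond_exp_shrinkage:
  "AE \<omega> in M. real_cond_exp M (vimage_algebra (space M) Y borel) (\<lambda>\<omega>. shrinkage (W \<omega>)) \<omega>
    = posterior_shrinkage (Y \<omega>)"
proof -
  let ?F = "vimage_algebra (space M) Y borel"
  have sets_F: "sets ?F = {Y -` B \<inter> space M | B. B \<in> sets borel}"
    by (rule sets_vimage_algebra2) auto
  have "subalgebra M ?F"
    by (auto simp: subalgebra_def sets_F)
  then interpret finite_measure_subalgebra M ?F
    by unfold_locales
  have int_shrinkage: "integrable M (\<lambda>\<omega>. shrinkage (W \<omega>))"
    using AE_W_pos shrinkage_bounds
    by (intro integrable_const_bound[where B = 1]) (auto simp: less_imp_le elim!: eventually_mono)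
  have int_posterior: "integrable M (\<lambda>\<omega>. posterior_shrinkage (Y \<omega>))"
    using posterior_shrinkage_bounds by (intro integrable_const_bound[where B = 1]) auto
  show ?thesis
  proof (rule real_cond_exp_charact[OF _ int_shrinkage int_posterior])
    have "Y \<in> borel_measurable ?F"
      by (rule measurable_vimage_algebra1) auto
    then show "(\<lambda>\<omega>. posterior_shrinkage (Y \<omega>)) \<in> borel_measurable ?F"
      by measurable
  next
    fix A assume "A \<in> sets ?F"
    then obtain B where [measurable]: "B \<in> sets borel" and A: "A = Y -` B \<inter> space M"
      by (auto simp: sets_F)
    let ?I = "indicator B :: real ^ 'n \<Rightarrow> real"
    have "(\<integral>\<omega>\<in>A. shrinkage (W \<omega>) \<partial>M) = (\<integral>\<omega>. ?I (Y \<omega>) * shrinkage (W \<omega>) \<partial>M)"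
      unfolding set_lebesgue_integral_def
      by (intro Bochner_Integration.integral_cong) (auto simp: A indicator_def)
    \<comment> \<open>The integrand is almost surely nonnegative, as W > 0 almost surely, so the
      iterated-integral formulas for nonnegative functions apply.\<close>
    also have "\<dots> = enn2real (\<integral>\<^sup>+\<omega>. ennreal (?I (Y \<omega>) * shrinkage (W \<omega>)) \<partial>M)"
      using AE_W_pos shrinkage_bounds
      by (intro integral_eq_nn_integral) (auto simp: less_imp_le elim!: eventually_mono)
    also have "(\<integral>\<^sup>+\<omega>. ennreal (?I (Y \<omega>) * shrinkage (W \<omega>)) \<partial>M)
        = (\<integral>\<^sup>+y. \<integral>\<^sup>+w. ennreal (WY_density b y w) * ennreal (?I y * shrinkage w) \<partial>lborel \<partial>lborel)"
      by (rule nn_integral_WY) measurable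
    also have "\<dots> = (\<integral>\<^sup>+y. ennreal (Y_density y) * ennreal (?I y * posterior_shrinkage y) \<partial>lborel)"
    proof (rule nn_integral_cong)
      fix y :: "real ^ 'n"
      have "(\<integral>\<^sup>+w. ennreal (WY_density b y w) * ennreal (?I y * shrinkage w) \<partial>lborel)
          = ennreal (\<integral>w. WY_density b y w * (?I y * shrinkage w) \<partial>lborel)"
        using shrinkage_bounds
        by (intro nn_integral_WY_density_times[where K = 1])
           (auto simp: indicator_def less_imp_le)
      also have "(\<integral>w. WY_density b y w * (?I y * shrinkage w) \<partial>lborel)
          = ?I y * (posterior_shrinkage y * Y_density y)"
        unfolding integral_WY_density_shrinkage[symmetric]
        by (subst integral_mult_right_zero[symmetric]) (simp add: ac_simps)
      finally show "(\<integral>\<^sup>+w. ennreal (WY_density b y w) * ennreal (?I y * shrinkage w) \<partial>lborel)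
          = ennreal (Y_density y) * ennreal (?I y * posterior_shrinkage y)"
        using Y_density_pos[of y] posterior_shrinkage_bounds[of y]
        by (simp add: ennreal_mult[symmetric] ac_simps)
    qed
    also have "\<dots> = (\<integral>\<^sup>+\<omega>. ennreal (?I (Y \<omega>) * posterior_shrinkage (Y \<omega>)) \<partial>M)"
      by (subst nn_integral_Y) auto
    also have "enn2real \<dots> = (\<integral>\<omega>. ?I (Y \<omega>) * posterior_shrinkage (Y \<omega>) \<partial>M)"
      by (intro integral_eq_nn_integral[symmetric]) (auto simp: posterior_shrinkage_bounds)
    also have "\<dots> = (\<integral>\<omega>\<in>A. posterior_shrinkage (Y \<omega>) \<partial>M)"
      unfolding set_lebesgue_integral_def
      by (intro Bochner_Integration.integral_cong) (auto simp: A indicator_def)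
    finally show "(\<integral>\<omega>\<in>A. shrinkage (W \<omega>) \<partial>M) = (\<integral>\<omega>\<in>A. posterior_shrinkage (Y \<omega>) \<partial>M)" .
  qed
qed

section \<open>The integrated risk and its posterior decomposition\<close>

definition prior :: "(real ^ 'n) measure" where
  "prior = distr M borel \<Theta>"

lemma prob_space_prior: "prob_space prior"
  unfolding prior_def by (rule prob_space_distr) simp

lemma sets_prior: "sets prior = sets borel"
  by (simp add: prior_def)

definition integrated_risk :: "(real ^ 'n \<Rightarrow> real ^ 'n) \<Rightarrow> ennreal" where
  "integrated_risk d = (\<integral>\<^sup>+\<theta>. risk \<theta> d \<partial>prior)"

text \<open>The density of y given theta has mass 1, so the risk, which is constant in y, may be
  averaged over y as well. Both sides then become integrals against the same joint density.\<close>

lemma integrated_risk_eq_expected_loss: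
  assumes d [measurable]: "estimator d"
  shows "integrated_risk d = (\<integral>\<^sup>+\<omega>. ennreal ((norm (\<Theta> \<omega> - d (Y \<omega>)))\<^sup>2) \<partial>M)"
proof -
  note [measurable] = measurable_risk[OF d]
  have eq: "(\<integral>\<^sup>+y. ennreal (hierarchical_density b (w, \<theta>, y)) * risk \<theta> d \<partial>lborel)
      = (\<integral>\<^sup>+y. ennreal (hierarchical_density b (w, \<theta>, y)) * ennreal ((norm (\<theta> - d y))\<^sup>2) \<partial>lborel)"
    for w and \<theta> :: "real ^ 'n"
    using b_pos nn_integral_mvn_density[of 1 \<theta>]
    by (simp add: hierarchical_density_def ennreal_mult beta_prime_1_density_nonneg mult.assoc
        nn_integral_cmult nn_integral_multc risk_eq[OF d])
  have "integrated_risk d = (\<integral>\<^sup>+\<omega>. risk (\<Theta> \<omega>) d \<partial>M)"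
    by (simp add: integrated_risk_def prior_def nn_integral_distr)
  also have "\<dots> = (\<integral>\<^sup>+w. \<integral>\<^sup>+\<theta>. \<integral>\<^sup>+y. ennreal (hierarchical_density b (w, \<theta>, y)) * risk \<theta> d
      \<partial>lborel \<partial>lborel \<partial>lborel)"
    by (rule nn_integral_joint) measurable
  also have "\<dots> = (\<integral>\<^sup>+\<omega>. ennreal ((norm (\<Theta> \<omega> - d (Y \<omega>)))\<^sup>2) \<partial>M)"
    unfolding eq by (rule nn_integral_joint[symmetric]) measurable
  finally show ?thesis .
qed

text \<open>For theta distributed as N(s y, s I) with s the shrinkage factor: the trace of the
  covariance plus the squared distance of the action a from the mean.\<close>

definition expected_loss_given_W :: "real ^ 'n \<Rightarrow> real ^ 'n \<Rightarrow> real \<Rightarrow> real" where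
  "expected_loss_given_W y a w = real CARD('n) * shrinkage w + (norm (shrinkage w *\<^sub>R y - a))\<^sup>2"

lemma measurable_expected_loss_given_W [measurable (raw)]:
  assumes [measurable]: "f \<in> borel_measurable N" "g \<in> borel_measurable N" "h \<in> borel_measurable N"
  shows "(\<lambda>x. expected_loss_given_W (f x) (g x) (h x)) \<in> borel_measurable N"
  unfolding expected_loss_given_W_def by measurable

lemma expected_loss_given_W_nonneg: "0 < w \<Longrightarrow> 0 \<le> expected_loss_given_W y a w"
  using shrinkage_bounds(1)[of w] by (simp add: expected_loss_given_W_def)

text \<open>The bound is uniform in w > 0 because the shrinkage factor stays below 1. It makes the
  posterior loss finite at each fixed y and a, so real integrals can be used there.\<close>

lemma expected_loss_given_W_bounded:
  assumes "0 < w"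
  shows "\<bar>expected_loss_given_W y a w\<bar> \<le> real CARD('n) + (norm y + norm a)\<^sup>2"
proof -
  have s: "0 < shrinkage w" "shrinkage w < 1"
    using assms by (auto intro: shrinkage_bounds)
  have "norm (shrinkage w *\<^sub>R y - a) \<le> norm (shrinkage w *\<^sub>R y) + norm a"
    by (rule norm_triangle_ineq4)
  also have "\<dots> \<le> norm y + norm a"
    using s by (simp add: mult_left_le_one_le)
  finally have "(norm (shrinkage w *\<^sub>R y - a))\<^sup>2 \<le> (norm y + norm a)\<^sup>2"
    by (intro power_mono) auto
  moreover have "real CARD('n) * shrinkage w \<le> real CARD('n)"
    using s by (simp add: mult_left_le)
  ultimately have "expected_loss_given_W y a w \<le> real CARD('n) + (norm y + norm a)\<^sup>2"
    unfolding expected_loss_given_W_def by linarith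
  then show ?thesis
    using expected_loss_given_W_nonneg[OF assms, of y a] by linarith
qed

lemma integrated_risk_eq_posterior:
  assumes [measurable]: "estimator d"
  shows "integrated_risk d = (\<integral>\<^sup>+y. \<integral>\<^sup>+w. ennreal (WY_density b y w) *
    ennreal (expected_loss_given_W y (d y) w) \<partial>lborel \<partial>lborel)"
proof -
  have "ennreal (WY_density b y w) *
      (\<integral>\<^sup>+\<theta>. ennreal (mvn_density (shrinkage w *\<^sub>R y) (shrinkage w) \<theta>) * ennreal ((norm (\<theta> - d y))\<^sup>2) \<partial>lborel)
      = ennreal (WY_density b y w) * ennreal (expected_loss_given_W y (d y) w)" for y w
    by (cases "0 < w")
       (simp_all add: nn_integral_mvn_second_moment shrinkage_bounds WY_density_eq_0
         expected_loss_given_W_def)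
  then show ?thesis
    unfolding integrated_risk_eq_expected_loss[OF assms]
    by (subst nn_integral_posterior) auto
qed

text \<open>Pythagoras for the posterior at a fixed y: the posterior mean is the centre, so the
  cross term integrates to 0.\<close>

lemma posterior_risk_decomposition:
  "(\<integral>\<^sup>+w. ennreal (WY_density b y w) * ennreal (expected_loss_given_W y a w) \<partial>lborel)
    = (\<integral>\<^sup>+w. ennreal (WY_density b y w) * ennreal (expected_loss_given_W y (posterior_mean y) w) \<partial>lborel)
      + ennreal (Y_density y) * ennreal ((norm (posterior_mean y - a))\<^sup>2)"
proof -
  let ?f = "WY_density b y" and ?m = "posterior_mean y" and ?c = "posterior_shrinkage y"
  let ?l = "expected_loss_given_W y"
  have int_loss: "integrable lborel (\<lambda>w. ?f w * ?l a' w)" for a'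
    by (rule integrable_WY_density_bounded[OF _ expected_loss_given_W_bounded]) measurable
  have nn_loss: "(\<integral>\<^sup>+w. ennreal (?f w) * ennreal (?l a' w) \<partial>lborel) = ennreal (\<integral>w. ?f w * ?l a' w \<partial>lborel)"
    for a'
    by (rule nn_integral_WY_density_times[OF _ expected_loss_given_W_bounded expected_loss_given_W_nonneg])
       measurable
  \<comment> \<open>With ?m = ?c y the cross term is 2 (s - ?c) times the inner product of y and ?m
    - a, where s is the shrinkage factor; it depends on w only through s.\<close>
  have expand: "?l a w = ?l ?m w + (shrinkage w * (2 * (y \<bullet> (?m - a)))
      - ?c * (2 * (y \<bullet> (?m - a))) + (norm (?m - a))\<^sup>2)" for w
    unfolding expected_loss_given_W_def posterior_mean_def power2_norm_eq_inner
    by (simp add: inner_diff_left inner_diff_right inner_commute[of a y]) (simp add: algebra_simps)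
  have "(\<integral>w. ?f w * ?l a w \<partial>lborel)
      = (\<integral>w. ?f w * ?l ?m w + (?f w * shrinkage w * (2 * (y \<bullet> (?m - a)))
        - ?f w * (?c * (2 * (y \<bullet> (?m - a)))) + ?f w * (norm (?m - a))\<^sup>2) \<partial>lborel)"
    unfolding expand by (simp add: algebra_simps)
  \<comment> \<open>The two middle terms cancel, since ?c is the weighted average of the shrinkage
    factor under ?f.\<close>
  also have "\<dots> = (\<integral>w. ?f w * ?l ?m w \<partial>lborel) + Y_density y * (norm (?m - a))\<^sup>2"
    by (simp add: int_loss integrable_WY_density integrable_WY_density_shrinkage
        integral_WY_density_shrinkage Y_density_def[symmetric])
  finally have "(\<integral>w. ?f w * ?l a w \<partial>lborel)
      = (\<integral>w. ?f w * ?l ?m w \<partial>lborel) + Y_density y * (norm (?m - a))\<^sup>2" .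
  moreover have "0 \<le> (\<integral>w. ?f w * ?l ?m w \<partial>lborel)"
  proof (rule integral_nonneg_AE, rule AE_I2)
    show "0 \<le> ?f w * ?l ?m w" for w
      using b_pos by (cases "0 < w") (simp_all add: WY_density_nonneg WY_density_eq_0 expected_loss_given_W_nonneg)
  qed
  ultimately show ?thesis
    using Y_density_pos[of y] unfolding nn_loss by (simp add: ennreal_mult[symmetric])
qed

section \<open>Optimality, uniqueness and admissibility\<close>

lemma integrated_risk_decomposition:
  assumes [measurable]: "estimator d"
  shows "integrated_risk d = integrated_risk posterior_mean
    + (\<integral>\<^sup>+y. ennreal (Y_density y) * ennreal ((norm (posterior_mean y - d y))\<^sup>2) \<partial>lborel)"
  unfolding integrated_risk_eq_posterior[OF assms] integrated_risk_eq_posterior[OF measurable_posterior(3)]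
  by (subst posterior_risk_decomposition) (simp add: nn_integral_add)

lemma integrated_risk_posterior_mean_le: "estimator d \<Longrightarrow> integrated_risk posterior_mean \<le> integrated_risk d"
  by (subst (2) integrated_risk_decomposition) auto

lemma integrated_risk_posterior_mean_finite: "integrated_risk posterior_mean < \<infinity>"
proof -
  have "integrated_risk posterior_mean \<le> integrated_risk (\<lambda>y. y)"
    by (rule integrated_risk_posterior_mean_le) simp
  also have "\<dots> = ennreal (real CARD('n))"
    using prob_space.emeasure_space_1[OF prob_space_prior] by (simp add: integrated_risk_def risk_id)
  finally show ?thesis
    by (simp add: le_less_trans)
qed

text \<open>The excess integrated risk of d is a squared distance to the posterior mean weighted by
  \<open>Y_density\<close>; if it vanishes, positivity of the weight forces agreement almost
  everywhere.\<close>

lemma posterior_mean_unique: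
  assumes [measurable]: "estimator d" and le: "integrated_risk d \<le> integrated_risk posterior_mean"
  shows "AE y in lborel. d y = posterior_mean y"
proof -
  let ?D = "\<integral>\<^sup>+y. ennreal (Y_density y) * ennreal ((norm (posterior_mean y - d y))\<^sup>2) \<partial>lborel"
  have "integrated_risk posterior_mean + ?D \<le> integrated_risk posterior_mean + 0"
    using le integrated_risk_decomposition[OF assms(1)] by simp
  \<comment> \<open>Cancellation in the extended reals relies on the finite integrated risk of the
    posterior mean.\<close>
  then have "?D \<le> 0"
    using integrated_risk_posterior_mean_finite by (subst (asm) ennreal_add_left_cancel_le) auto
  then have "AE y in lborel. ennreal (Y_density y) * ennreal ((norm (posterior_mean y - d y))\<^sup>2) = 0"
    by (subst (asm) le_zero_eq, subst (asm) nn_integral_0_iff_AE) auto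
  then show ?thesis
  proof eventually_elim
    fix y assume "ennreal (Y_density y) * ennreal ((norm (posterior_mean y - d y))\<^sup>2) = 0"
    then show "d y = posterior_mean y"
      using Y_density_pos[of y] by auto
  qed
qed

text \<open>An estimator whose risk is nowhere larger than that of d also attains the minimal
  integrated risk. By uniqueness it equals the posterior mean almost everywhere, so its risk
  function is that of d and strict improvement at some theta is impossible.\<close>

lemma proper_bayes_and_admissible:
  assumes d: "estimator d" and eq: "AE y in lborel. d y = posterior_mean y"
  shows "proper_bayes_estimator prior d" and "admissible d"
proof -
  have risk_eq: "risk \<theta> d = risk \<theta> posterior_mean" for \<theta>
    by (rule risk_cong_AE[OF d measurable_posterior(3) eq])
  show "proper_bayes_estimator prior d"
    using integrated_risk_posterior_mean_finite integrated_risk_posterior_mean_le d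
      prob_space_prior sets_prior
    by (simp add: proper_bayes_estimator_def risk_eq integrated_risk_def)
  have False if d': "estimator d'" and le: "\<And>\<theta>. risk \<theta> d' \<le> risk \<theta> d" and "risk \<theta> d' < risk \<theta> d"
    for d' \<theta>
  proof -
    have "integrated_risk d' \<le> integrated_risk posterior_mean"
      using le unfolding integrated_risk_def risk_eq by (rule nn_integral_mono)
    from risk_cong_AE[OF d' measurable_posterior(3) posterior_mean_unique[OF d' this]]
    show False using that(3) by (simp add: risk_eq)
  qed
  then show "admissible d"
    using d unfolding admissible_def by blast
qed

end

theorem corollary3p2:
  fixes M :: "'a measure"
    and W :: "'a \<Rightarrow> real"
    and \<Theta> Y :: "'a \<Rightarrow> real ^ 'n::finite"
    and \<delta> :: "real ^ 'n \<Rightarrow> real ^ 'n"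
  assumes "CARD('n) \<ge> 5"
    and "prob_space M"
    and "distributed M (lborel \<Otimes>\<^sub>M lborel \<Otimes>\<^sub>M lborel) (\<lambda>\<omega>. (W \<omega>, \<Theta> \<omega>, Y \<omega>))
           (\<lambda>z. ennreal (hierarchical_density (real CARD('n) / 2 - 2) z))"
    and "estimator \<delta>"
    and "AE \<omega> in M. \<delta> (Y \<omega>) =
           real_cond_exp M (vimage_algebra (space M) Y borel) (\<lambda>\<omega>. W \<omega> / (1 + W \<omega>)) \<omega> *\<^sub>R Y \<omega>"
  shows "proper_bayes_estimator (distr M borel \<Theta>) \<delta> \<and> admissible \<delta>"
proof -
  note [measurable] = assms(4)
  \<comment> \<open>Dimension at least 5 makes p/2 - 2 at least 1/2, which gives
    \<open>b_pos\<close>.\<close>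
  interpret scale_mixture_model M W \<Theta> Y "real CARD('n) / 2 - 2"
    using assms(1-3) by (auto simp: scale_mixture_model_def scale_mixture_model_axioms_def)
  have "AE \<omega> in M. \<delta> (Y \<omega>) = posterior_mean (Y \<omega>)"
    using assms(5) real_cond_exp_shrinkage[unfolded shrinkage_def]
    by eventually_elim (simp add: posterior_mean_def)
  \<comment> \<open>The conditional expectation determines \<delta> only almost surely along Y;
    positivity of the density of Y carries this over to Lebesgue almost every y.\<close>
  then have "AE y in lborel. \<delta> y = posterior_mean y"
    by (rule AE_lborel_if_AE_Y[rotated]) measurable
  from proper_bayes_and_admissible[OF assms(4) this] show ?thesis
    by (simp add: prior_def)
qed

end
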